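(* Let $\mathcal{G}$ be a groupoid, let $\mathcal{H}$ be a wide subgroupoid of $\mathcal{G}$, and let $\mathcal{G}'$ be the commutator subgroupoid of $\mathcal{G}$. Then: 1. $\mathcal{G}'=\bigsqcup_{e\in\mathcal{G}_0}\mathcal{G}_e'$, where $\mathcal{G}_e'$ is the commutator subgroup of the group $\mathcal{G}_e$. 2. $\mathcal{G}'=\mathcal{G}_0$ if and only if $\mathcal{G}$ is an abelian groupoid. 3. If $\mathcal{H}$ is a normal subgroupoid of $\mathcal{G}$, then $[\mathcal{H},\mathcal{G}]$ is a subgroupoid of $\mathcal{H}$. 4. $\mathcal{G}'$ is a normal subgroupoid of $\mathcal{G}$ and $\mathcal{G}/\mathcal{G}'$ is an abelian groupoid. 5. $\mathcal{G}/\mathcal{G}'$ is the largest abelian quotient of $\mathcal{G}$ in the sense that if $\mathcal{H}$ is a normal subgroupoid of $\mathcal{G}$ and $\mathcal{G}/\mathcal{H}$ is abelian, then $\mathcal{G}'$ is a subgroupoid of $\mathcal{H}$. 6. If $\sigma:\mathcal{G}\to\mathcal{A}$ is any homomorphism of $\mathcal{G}$ into an abelian groupoid $\mathcal{A}$, then there exists a homomorphism $\theta:\mathcal{G}/\mathcal{G}'\to\mathcal{A}$ such that $\sigma=\theta\circ j$, where $j:\mathcal{G}\to\mathcal{G}/\mathcal{G}'$, $j(g)=g\mathcal{G}'$, is the canonical homomorphism.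
   Context: Groupoids are taken in the algebraic sense. Let $\mathcal{G}$ be a set with a partial binary operation written as concatenation; $\exists gh$ means that the product $gh$ is defined. An element $e\in\mathcal{G}$ is an identity if $\exists eg$ implies $eg=g$ and $\exists g'e$ implies $g'e=g'$; $\mathcal{G}_0$ is the set of identities. $\mathcal{G}$ is a groupoid if: (1) $\exists g(hl)$ iff $\exists (gh)l$, and then $g(hl)=(gh)l$; (2) $\exists g(hl)$ iff $\exists gh$ and $\exists hl$; (3) for each $g$ there are unique $d(g),r(g)\in\mathcal{G}$ with $\exists g\,d(g)$, $\exists r(g)\,g$ and $g\,d(g)=g=r(g)\,g$; (4) for each $g$ there is $g^{-1}\in\mathcal{G}$ with $d(g)=g^{-1}g$ and $r(g)=gg^{-1}$. (Equivalently, $\mathcal{G}$ is the set of morphisms of a small category in which every morphism is invertible; $\exists gh$ iff $d(g)=r(h)$, and $\mathcal{G}_0=\{d(g)\mid g\in\mathcal{G}\}$.) For $e\in\mathcal{G}_0$, $\mathcal{G}_e=\{g\in\mathcal{G}\mid d(g)=r(g)=e\}$ is the isotropy group at $e$ (a group with identity $e$). $\mathcal{G}$ is abelian if all its isotropy groups $\mathcal{G}_e$ are abelian. A nonempty subset $\mathcal{H}\subseteq\mathcal{G}$ is a subgroupoid of $\mathcal{G}$ if for all $g,h\in\mathcal{H}$: $g^{-1}\in\mathcal{H}$, and $\exists gh$ implies $gh\in\mathcal{H}$. It is wide if $\mathcal{H}_0=\mathcal{G}_0$, equivalently $\mathcal{G}_0\subseteq\mathcal{H}$. For a wide subgroupoid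 $\mathcal{H}$ and $e\in\mathcal{G}_0$, $\mathcal{H}_e=\mathcal{H}\cap\mathcal{G}_e$; for $g\in\mathcal{G}$, $g^{-1}\mathcal{H}g=\{g^{-1}hg\mid h\in\mathcal{H},\ r(h)=d(h)=r(g)\}$. A subgroupoid $\mathcal{H}$ of $\mathcal{G}$ is normal if it is wide and $g^{-1}\mathcal{H}g\subseteq\mathcal{H}$ for all $g\in\mathcal{G}$. For $\emptyset\neq B\subseteq\mathcal{G}$, $\langle B\rangle$ is the smallest subgroupoid of $\mathcal{G}$ containing $B$. Commutators: for $e\in\mathcal{G}_0$ and $x,y\in\mathcal{G}_e$, $[x,y]=x^{-1}y^{-1}xy$. The commutator subgroupoid is $\mathcal{G}'=\langle [x,y]\mid x,y\in\mathcal{G}_e,\ e\in\mathcal{G}_0\rangle$. For wide subgroupoids $\mathcal{H},\mathcal{K}$ of $\mathcal{G}$, $[\mathcal{H},\mathcal{K}]=\langle [x,y]\mid x\in\mathcal{H}_e,\ y\in\mathcal{K}_e,\ e\in\mathcal{G}_0\rangle$. Quotients: for a wide subgroupoid $\mathcal{H}$, define $g\equiv_{\mathcal{H}}l$ iff $\exists l^{-1}g$ and $l^{-1}g\in\mathcal{H}$; this is an equivalence relation, and the class of $g$ is the left coset $g\mathcal{H}=\{gh\mid h\in\mathcal{H},\ r(h)=d(g)\}$. If $\mathcal{H}$ is normal, the quotient groupoid $\mathcal{G}/\mathcal{H}$ is the set of all left cosets, with $\exists (g\mathcal{H})(l\mathcal{H})$ if and only if $\exists gl$, and in that case $(g\mathcal{H})(l\mathcal{H})=gl\mathcal{H}$.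 A map $\phi:\mathcal{G}\to\mathcal{A}$ between groupoids is a homomorphism if for all $x,y\in\mathcal{G}$, $\exists xy$ implies $\exists\phi(x)\phi(y)$ and $\phi(xy)=\phi(x)\phi(y)$. *)

theory Defs
  imports "HOL-Algebra.Generated_Groups" "HOL-Library.Disjoint_Sets"
begin

(* A set with a partial binary operation.  The value None means that the product is not
   defined; the locale groupoid below makes products outside the carrier undefined. *)
record 'a partial_magma = "'a partial_object" +
  pmult :: "'a \<Rightarrow> 'a \<Rightarrow> 'a option"

definition defined :: "('a, 'm) partial_magma_scheme \<Rightarrow> 'a \<Rightarrow> 'a \<Rightarrow> bool"
  where "defined G g h \<longleftrightarrow> pmult G g h \<noteq> None"

(* The product as a total function; meaningful only where it is defined. *)
definition prd :: "('a, 'm) partial_magma_scheme \<Rightarrow> 'a \<Rightarrow> 'a \<Rightarrow> 'a"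
  where "prd G g h = the (pmult G g h)"

definition identities :: "('a, 'm) partial_magma_scheme \<Rightarrow> 'a set"
  where "identities G = {e \<in> carrier G.
    (\<forall>g\<in>carrier G. defined G e g \<longrightarrow> prd G e g = g) \<and>
    (\<forall>g\<in>carrier G. defined G g e \<longrightarrow> prd G g e = g)}"

definition dom_id :: "('a, 'm) partial_magma_scheme \<Rightarrow> 'a \<Rightarrow> 'a"
  where "dom_id G g = (THE e. e \<in> carrier G \<and> defined G g e \<and> prd G g e = g)"

definition ran_id :: "('a, 'm) partial_magma_scheme \<Rightarrow> 'a \<Rightarrow> 'a"
  where "ran_id G g = (THE e. e \<in> carrier G \<and> defined G e g \<and> prd G e g = g)"

definition is_ginv :: "('a, 'm) partial_magma_scheme \<Rightarrow> 'a \<Rightarrow> 'a \<Rightarrow> bool"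
  where "is_ginv G g h \<longleftrightarrow> h \<in> carrier G \<and>
    defined G h g \<and> prd G h g = dom_id G g \<and> defined G g h \<and> prd G g h = ran_id G g"

definition ginv :: "('a, 'm) partial_magma_scheme \<Rightarrow> 'a \<Rightarrow> 'a"
  where "ginv G g = (THE h. is_ginv G g h)"

(* Existence of the iterated product g(hl) means that hl and then g(hl) are defined. *)
locale groupoid =
  fixes G :: "('a, 'm) partial_magma_scheme" (structure)
  assumes pmult_carrier:
      "pmult G g h = Some k \<Longrightarrow> g \<in> carrier G \<and> h \<in> carrier G \<and> k \<in> carrier G"
    and assoc_defined: "\<lbrakk>g \<in> carrier G; h \<in> carrier G; l \<in> carrier G\<rbrakk> \<Longrightarrow>
      (defined G h l \<and> defined G g (prd G h l)) \<longleftrightarrow> (defined G g h \<and> defined G (prd G g h) l)"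
    and assoc: "\<lbrakk>g \<in> carrier G; h \<in> carrier G; l \<in> carrier G;
      defined G h l; defined G g (prd G h l)\<rbrakk> \<Longrightarrow>
      prd G g (prd G h l) = prd G (prd G g h) l"
    and triple_defined: "\<lbrakk>g \<in> carrier G; h \<in> carrier G; l \<in> carrier G\<rbrakk> \<Longrightarrow>
      (defined G h l \<and> defined G g (prd G h l)) \<longleftrightarrow> (defined G g h \<and> defined G h l)"
    and dom_id_ex1: "g \<in> carrier G \<Longrightarrow> \<exists>!e. e \<in> carrier G \<and> defined G g e \<and> prd G g e = g"
    and ran_id_ex1: "g \<in> carrier G \<Longrightarrow> \<exists>!e. e \<in> carrier G \<and> defined G e g \<and> prd G e g = g"
    and ginv_ex: "g \<in> carrier G \<Longrightarrow> \<exists>h. is_ginv G g h"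

definition isotropy :: "('a, 'm) partial_magma_scheme \<Rightarrow> 'a \<Rightarrow> 'a set"
  where "isotropy G e = {g \<in> carrier G. dom_id G g = e \<and> ran_id G g = e}"

definition isotropy_group :: "('a, 'm) partial_magma_scheme \<Rightarrow> 'a \<Rightarrow> 'a monoid"
  where "isotropy_group G e = \<lparr>carrier = isotropy G e, mult = prd G, one = e\<rparr>"

definition abelian_groupoid :: "('a, 'm) partial_magma_scheme \<Rightarrow> bool"
  where "abelian_groupoid G \<longleftrightarrow>
    groupoid G \<and> (\<forall>e\<in>identities G. comm_group (isotropy_group G e))"

definition subgroupoid :: "'a set \<Rightarrow> ('a, 'm) partial_magma_scheme \<Rightarrow> bool"
  where "subgroupoid H G \<longleftrightarrow> H \<noteq> {} \<and> H \<subseteq> carrier G \<and>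
    (\<forall>g\<in>H. ginv G g \<in> H) \<and> (\<forall>g\<in>H. \<forall>h\<in>H. defined G g h \<longrightarrow> prd G g h \<in> H)"

definition restr :: "('a, 'm) partial_magma_scheme \<Rightarrow> 'a set \<Rightarrow> 'a partial_magma"
  where "restr G H =
    \<lparr>carrier = H, pmult = (\<lambda>g h. if g \<in> H \<and> h \<in> H then pmult G g h else None)\<rparr>"

definition wide_subgroupoid :: "'a set \<Rightarrow> ('a, 'm) partial_magma_scheme \<Rightarrow> bool"
  where "wide_subgroupoid H G \<longleftrightarrow> subgroupoid H G \<and> identities (restr G H) = identities G"

definition conj_set :: "('a, 'm) partial_magma_scheme \<Rightarrow> 'a set \<Rightarrow> 'a \<Rightarrow> 'a set"
  where "conj_set G H g = {prd G (prd G (ginv G g) h) g | h.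
    h \<in> H \<and> ran_id G h = ran_id G g \<and> dom_id G h = ran_id G g}"

definition normal_subgroupoid :: "'a set \<Rightarrow> ('a, 'm) partial_magma_scheme \<Rightarrow> bool"
  where "normal_subgroupoid H G \<longleftrightarrow>
    wide_subgroupoid H G \<and> (\<forall>g\<in>carrier G. conj_set G H g \<subseteq> H)"

definition gen_subgroupoid :: "('a, 'm) partial_magma_scheme \<Rightarrow> 'a set \<Rightarrow> 'a set"
  where "gen_subgroupoid G B = \<Inter>{H. subgroupoid H G \<and> B \<subseteq> H}"

definition commutator :: "('a, 'm) partial_magma_scheme \<Rightarrow> 'a \<Rightarrow> 'a \<Rightarrow> 'a"
  where "commutator G x y = prd G (prd G (prd G (ginv G x) (ginv G y)) x) y"

definition commutator_subgroupoid :: "('a, 'm) partial_magma_scheme \<Rightarrow> 'a set"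
  where "commutator_subgroupoid G = gen_subgroupoid G
    {commutator G x y | x y e. e \<in> identities G \<and> x \<in> isotropy G e \<and> y \<in> isotropy G e}"

definition mutual_commutator :: "('a, 'm) partial_magma_scheme \<Rightarrow> 'a set \<Rightarrow> 'a set \<Rightarrow> 'a set"
  where "mutual_commutator G H K = gen_subgroupoid G
    {commutator G x y | x y e. e \<in> identities G \<and> x \<in> H \<inter> isotropy G e \<and> y \<in> K \<inter> isotropy G e}"

definition left_coset :: "('a, 'm) partial_magma_scheme \<Rightarrow> 'a set \<Rightarrow> 'a \<Rightarrow> 'a set"
  where "left_coset G H g = {prd G g h | h. h \<in> H \<and> ran_id G h = dom_id G g}"

(* The product of two cosets is defined iff some representatives g, l have a product, and it is
   then the coset of gl.  For normal H this coset does not depend on the composable pair g, l.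
   If H has elements outside the isotropy groups, then a coset contains elements with different
   domains, whether gl is defined does depend on the representatives, and the result is not a
   groupoid. *)
definition quotient_groupoid ::
    "('a, 'm) partial_magma_scheme \<Rightarrow> 'a set \<Rightarrow> 'a set partial_magma"
  where "quotient_groupoid G H =
    \<lparr>carrier = left_coset G H ` carrier G,
     pmult = (\<lambda>X Y.
       if \<exists>g\<in>carrier G. \<exists>l\<in>carrier G.
            X = left_coset G H g \<and> Y = left_coset G H l \<and> defined G g l
       then Some (THE Z. \<exists>g\<in>carrier G. \<exists>l\<in>carrier G.
            X = left_coset G H g \<and> Y = left_coset G H l \<and> defined G g l \<and>
            Z = left_coset G H (prd G g l))
       else None)\<rparr>"

definition groupoid_hom ::
    "('a, 'm) partial_magma_scheme \<Rightarrow> ('b, 'n) partial_magma_scheme \<Rightarrow> ('a \<Rightarrow> 'b) set"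
  where "groupoid_hom G A = {f. f \<in> carrier G \<rightarrow> carrier A \<and>
    (\<forall>x\<in>carrier G. \<forall>y\<in>carrier G. defined G x y \<longrightarrow>
      defined A (f x) (f y) \<and> f (prd G x y) = prd A (f x) (f y))}"

end

theory Submission
  imports Defs
begin

text \<open>
  Everything rests on one observation: if \<open>\<sigma>\<close> is a homomorphism into an abelian groupoid, then the
  isotropy elements that \<open>\<sigma>\<close> sends to identities form a subgroupoid containing all commutators, hence
  containing the commutator subgroupoid. Applied to the identity map this shows that the commutator
  subgroupoid of an abelian groupoid is trivial, applied to the projection onto an abelian quotient
  it shows that the commutator subgroupoid lies in the kernel, and applied to an arbitrary \<open>\<sigma>\<close> it
  gives the factorisation of \<open>\<sigma>\<close>.
\<close>

section \<open>Groupoids as categories of isomorphisms\<close>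

text \<open>The axioms do not say which pairs compose, so the criterion \<open>d g = r h\<close> has
  to be derived before words can be rewritten. The quotient by \<open>G'\<close> must itself be
  shown to be a groupoid. This hinges on \<open>G'\<close> consisting of isotropy elements: then a
  coset of \<open>G'\<close> determines the domain of its elements as well as their range, and
  composability of cosets does not depend on representatives. For another normal subgroupoid this
  can fail, so there the groupoid property of the quotient enters only through the hypothesis that
  the quotient is abelian. An empty structure satisfies the axioms but has no subgroupoids, so
  \<open>gen_subgroupoid\<close> would be an intersection over the empty family, that is, the whole
  type. This is why \<open>carrier G \<noteq> {}\<close> accompanies most facts about
  \<open>G'\<close>.\<close>

context groupoid
begin

abbreviation gmult (infixl "\<cdot>" 70) where "g \<cdot> h \<equiv> prd G g h"
abbreviation d where "d \<equiv> dom_id G"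
abbreviation r where "r \<equiv> ran_id G"
abbreviation iv where "iv \<equiv> ginv G"

lemma defined_carrier: "defined G g h \<Longrightarrow> g \<in> carrier G \<and> h \<in> carrier G \<and> g \<cdot> h \<in> carrier G"
  unfolding defined_def prd_def using pmult_carrier by fastforce

lemma dom_id_props:
  assumes "g \<in> carrier G"
  shows "d g \<in> carrier G" "defined G g (d g)" "g \<cdot> d g = g"
  using theI'[OF dom_id_ex1[OF assms]] unfolding dom_id_def by blast+

lemma ran_id_props:
  assumes "g \<in> carrier G"
  shows "r g \<in> carrier G" "defined G (r g) g" "r g \<cdot> g = g"
  using theI'[OF ran_id_ex1[OF assms]] unfolding ran_id_def by blast+

lemma dom_id_unique: "\<lbrakk>g \<in> carrier G; defined G g e; g \<cdot> e = g\<rbrakk> \<Longrightarrow> d g = e"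
  using dom_id_ex1 dom_id_props defined_carrier by metis

lemma ran_id_unique: "\<lbrakk>g \<in> carrier G; defined G e g; e \<cdot> g = g\<rbrakk> \<Longrightarrow> r g = e"
  using ran_id_ex1 ran_id_props defined_carrier by metis

text \<open>Bracketing \<open>g\<close>, \<open>d g\<close>, \<open>d g\<close> in both ways shows
  that \<open>d g \<cdot> d g\<close> is again a right unit of \<open>g\<close>, and right units of
  \<open>g\<close> are unique. Idempotence is what can be proved about \<open>d g\<close> before
  composability is understood.\<close>

lemma idempotent_dom_id:
  assumes "g \<in> carrier G"
  shows "defined G (d g) (d g) \<and> d g \<cdot> d g = d g"
proof -
  note p = dom_id_props[OF assms]
  have dd: "defined G (d g) (d g)" and gdd: "defined G g (d g \<cdot> d g)"
    using assoc_defined[of g "d g" "d g"] assms p by auto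
  have "g \<cdot> (d g \<cdot> d g) = g" using assoc[of g "d g" "d g"] assms p dd gdd by auto
  then show ?thesis using dd gdd dom_id_unique assms by metis
qed

lemma idempotent_ran_id:
  assumes "g \<in> carrier G"
  shows "defined G (r g) (r g) \<and> r g \<cdot> r g = r g"
proof -
  note p = ran_id_props[OF assms]
  have rr: "defined G (r g) (r g)" and rrg: "defined G (r g \<cdot> r g) g"
    using assoc_defined[of "r g" "r g" g] triple_defined[of "r g" "r g" g] assms p by auto
  have "(r g \<cdot> r g) \<cdot> g = g" using assoc[of "r g" "r g" g] assms p by auto
  then show ?thesis using rr rrg ran_id_unique assms by metis
qed

text \<open>
  With \<open>u\<close> inverse to \<open>e f\<close> one has \<open>e (f u) = e\<close>, so \<open>f u = e\<close> by uniqueness of domains, and then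
  \<open>f e = e\<close> forces \<open>f = e\<close> by uniqueness of ranges.
\<close>
lemma composable_idempotents_eq:
  assumes e: "defined G e e" "e \<cdot> e = e" and f: "defined G f f" "f \<cdot> f = f" and ef: "defined G e f"
  shows "e = f"
proof -
  have c: "e \<in> carrier G" "f \<in> carrier G" "e \<cdot> f \<in> carrier G" using defined_carrier[OF ef] by auto
  have "defined G e (e \<cdot> f)" using triple_defined[of e e f] c e ef by blast
  moreover have "e \<cdot> (e \<cdot> f) = e \<cdot> f" using assoc[of e e f] c e ef calculation by simp
  ultimately have rk: "r (e \<cdot> f) = e" using c ran_id_unique by blast
  obtain u where u: "u \<in> carrier G" "defined G (e \<cdot> f) u" "(e \<cdot> f) \<cdot> u = e"
    using ginv_ex[OF c(3)] rk unfolding is_ginv_def by auto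
  have fu: "defined G f u" "defined G e (f \<cdot> u)"
    using assoc_defined[of e f u] c u ef by auto
  have "e \<cdot> (f \<cdot> u) = e" using assoc[of e f u] c u fu by simp
  then have "f \<cdot> u = e" using dom_id_unique[of e "f \<cdot> u"] dom_id_unique[of e e] c e fu by auto
  moreover have "defined G f (f \<cdot> u)" using triple_defined[of f f u] c u f fu by blast
  moreover have "f \<cdot> (f \<cdot> u) = f \<cdot> u" using assoc[of f f u] c u f fu calculation by simp
  ultimately have "r e = f" using c ran_id_unique by auto
  then show ?thesis using ran_id_unique[of e e] c e by simp
qed

text \<open>Composability of \<open>g\<close> with \<open>h\<close> passes to \<open>d g\<close>
  with \<open>h\<close>, and then to \<open>d g\<close> with \<open>r h\<close>; these are
  composable idempotents, hence equal. Conversely, the common unit is a middle factor for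
  \<open>triple_defined\<close>. From here on partiality is a side condition on \<open>d\<close> and
  \<open>r\<close>.\<close>

lemma defined_iff: "defined G g h \<longleftrightarrow> g \<in> carrier G \<and> h \<in> carrier G \<and> d g = r h"
proof
  assume gh: "defined G g h"
  then have c: "g \<in> carrier G" "h \<in> carrier G" using defined_carrier by auto
  note p = dom_id_props[OF c(1)] and q = ran_id_props[OF c(2)]
  have "defined G (d g) h" using assoc_defined[of g "d g" h] c p gh by simp
  then have "defined G (d g) (r h)" using assoc_defined[of "d g" "r h" h] c p q by simp
  then have "d g = r h"
    using composable_idempotents_eq idempotent_dom_id[OF c(1)] idempotent_ran_id[OF c(2)] by blast
  with c show "g \<in> carrier G \<and> h \<in> carrier G \<and> d g = r h" by simp
next
  assume a: "g \<in> carrier G \<and> h \<in> carrier G \<and> d g = r h"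
  then show "defined G g h"
    using triple_defined[of g "d g" h] dom_id_props[of g] ran_id_props[of h] by auto
qed

section \<open>Rewriting words by means of domains and ranges\<close>

lemma dom_id_closed [simp]: "g \<in> carrier G \<Longrightarrow> d g \<in> carrier G"
  and ran_id_closed [simp]: "g \<in> carrier G \<Longrightarrow> r g \<in> carrier G"
  and prd_dom_id [simp]: "g \<in> carrier G \<Longrightarrow> g \<cdot> d g = g"
  and ran_id_prd [simp]: "g \<in> carrier G \<Longrightarrow> r g \<cdot> g = g"
  by (simp_all add: dom_id_props ran_id_props)

lemma prd_closed [simp]: "\<lbrakk>g \<in> carrier G; h \<in> carrier G; d g = r h\<rbrakk> \<Longrightarrow> g \<cdot> h \<in> carrier G"
  using defined_iff defined_carrier by blast

lemma dom_dom [simp]: "g \<in> carrier G \<Longrightarrow> d (d g) = d g"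
  and ran_dom [simp]: "g \<in> carrier G \<Longrightarrow> r (d g) = d g"
  and dom_ran [simp]: "g \<in> carrier G \<Longrightarrow> d (r g) = r g"
  and ran_ran [simp]: "g \<in> carrier G \<Longrightarrow> r (r g) = r g"
  using idempotent_dom_id idempotent_ran_id dom_id_unique ran_id_unique
  by (meson dom_id_closed ran_id_closed)+

text \<open>Oriented towards right-nested words; the side conditions are settled by the rules for
  \<open>d\<close> and \<open>r\<close>, so equations between words can be left to the
  simplifier.\<close>

lemma prd_assoc [simp]:
  assumes "g \<in> carrier G" "h \<in> carrier G" "l \<in> carrier G" "d g = r h" "d h = r l"
  shows "(g \<cdot> h) \<cdot> l = g \<cdot> (h \<cdot> l)"
  using assms assoc[of g h l] triple_defined[of g h l] defined_iff by auto

lemma dom_prd [simp]: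
  assumes "g \<in> carrier G" "h \<in> carrier G" "d g = r h"
  shows "d (g \<cdot> h) = d h"
  using assms assoc_defined[of g h "d h"] triple_defined[of g h "d h"]
  by (metis defined_iff dom_id_closed ran_dom)

lemma ran_prd [simp]:
  assumes "g \<in> carrier G" "h \<in> carrier G" "d g = r h"
  shows "r (g \<cdot> h) = r g"
  using assms triple_defined[of "r g" g h] by (metis defined_iff dom_ran ran_id_closed)

lemma is_ginv_unique:
  assumes g: "g \<in> carrier G" and h: "is_ginv G g h" and k: "is_ginv G g k"
  shows "h = k"
proof -
  have c: "h \<in> carrier G" "k \<in> carrier G" "d h = r g" "d g = r h" "d k = r g" "d g = r k"
    "h \<cdot> g = d g" "g \<cdot> k = r g"
    using h k unfolding is_ginv_def defined_iff by auto
  have "h = h \<cdot> (g \<cdot> k)" using c prd_dom_id[of h] by metis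
  also have "\<dots> = (h \<cdot> g) \<cdot> k" using c g by (metis prd_assoc)
  also have "\<dots> = k" using c ran_id_prd[of k] by metis
  finally show ?thesis .
qed

lemma ginv_is_ginv: "g \<in> carrier G \<Longrightarrow> is_ginv G g (iv g)"
  unfolding ginv_def by (rule theI') (use ginv_ex is_ginv_unique in blast)

lemma ginv_eqI: "\<lbrakk>g \<in> carrier G; is_ginv G g h\<rbrakk> \<Longrightarrow> iv g = h"
  by (rule is_ginv_unique[OF _ ginv_is_ginv])

lemma ginv_closed [simp]: "g \<in> carrier G \<Longrightarrow> iv g \<in> carrier G"
  and dom_ginv [simp]: "g \<in> carrier G \<Longrightarrow> d (iv g) = r g"
  and ran_ginv [simp]: "g \<in> carrier G \<Longrightarrow> r (iv g) = d g"
  and ginv_prd_self [simp]: "g \<in> carrier G \<Longrightarrow> iv g \<cdot> g = d g"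
  and prd_ginv_self [simp]: "g \<in> carrier G \<Longrightarrow> g \<cdot> iv g = r g"
  by (drule ginv_is_ginv, simp only: is_ginv_def defined_iff)+

lemma ran_prd_left [simp]: "\<lbrakk>h \<in> carrier G; r h = e\<rbrakk> \<Longrightarrow> e \<cdot> h = h"
  and prd_dom_right [simp]: "\<lbrakk>g \<in> carrier G; d g = e\<rbrakk> \<Longrightarrow> g \<cdot> e = g"
  by auto

text \<open>In right-nested words an adjacent pair \<open>iv g\<close>, \<open>g\<close> is no
  longer a subterm, so cancellation is stated with a trailing factor \<open>h\<close>.\<close>

lemma ginv_cancel_left [simp]:
  assumes "g \<in> carrier G" "h \<in> carrier G" "d g = r h"
  shows "iv g \<cdot> (g \<cdot> h) = h"
  using prd_assoc[of "iv g" g h] assms by simp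

lemma cancel_ginv_left [simp]:
  assumes "g \<in> carrier G" "h \<in> carrier G" "r g = r h"
  shows "g \<cdot> (iv g \<cdot> h) = h"
  using prd_assoc[of g "iv g" h] assms by simp

lemma ginv_ginv [simp]: "g \<in> carrier G \<Longrightarrow> iv (iv g) = g"
  by (rule ginv_eqI) (simp_all add: is_ginv_def defined_iff)

lemma ginv_prd [simp]:
  "\<lbrakk>g \<in> carrier G; h \<in> carrier G; d g = r h\<rbrakk> \<Longrightarrow> iv (g \<cdot> h) = iv h \<cdot> iv g"
  by (rule ginv_eqI) (simp_all add: is_ginv_def defined_iff)

text \<open>The product \<open>e \<cdot> d e\<close> is \<open>d e\<close> because \<open>e\<close>
  is a left unit, and \<open>e\<close> because \<open>d e\<close> is a right unit of
  \<open>e\<close>.\<close>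

lemma identities_iff: "e \<in> identities G \<longleftrightarrow> e \<in> carrier G \<and> d e = e"
proof
  assume e: "e \<in> identities G"
  then have c: "e \<in> carrier G" unfolding identities_def by simp
  have "e \<cdot> d e = d e" using e dom_id_props[OF c] unfolding identities_def by blast
  then show "e \<in> carrier G \<and> d e = e" using c by simp
next
  assume "e \<in> carrier G \<and> d e = e"
  moreover from this have "r e = e" using ran_dom by metis
  ultimately show "e \<in> identities G" unfolding identities_def defined_iff by auto
qed

lemma identities_dom [simp]: "e \<in> identities G \<Longrightarrow> d e = e"
  and identities_carrier [simp]: "e \<in> identities G \<Longrightarrow> e \<in> carrier G"
  and dom_in_identities [simp]: "g \<in> carrier G \<Longrightarrow> d g \<in> identities G"
  and ran_in_identities [simp]: "g \<in> carrier G \<Longrightarrow> r g \<in> identities G"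
  by (auto simp: identities_iff)

lemma identities_ran [simp]: "e \<in> identities G \<Longrightarrow> r e = e"
  using ran_dom by (metis identities_iff)

lemma identities_ginv [simp]: "e \<in> identities G \<Longrightarrow> iv e = e"
  by (rule ginv_eqI) (simp_all add: is_ginv_def defined_iff)

text \<open>The word \<open>iv l \<cdot> g\<close> has range \<open>d l\<close>; as an identity it
  equals \<open>d l\<close>, and multiplying by \<open>l\<close> on the left gives the claim. Both
  commuting of isotropy elements and independence of coset representatives are reduced to
  this.\<close>

lemma eq_if_ginv_prd_identity:
  assumes c: "g \<in> carrier G" "l \<in> carrier G" "r g = r l" and i: "iv l \<cdot> g \<in> identities G"
  shows "g = l"
proof -
  have "d (iv l \<cdot> g) = d g" "r (iv l \<cdot> g) = d l" using c by simp_all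
  then have "iv l \<cdot> g = d l" using identities_ran[OF i] by simp
  moreover have "l \<cdot> (iv l \<cdot> g) = g" using c by simp
  ultimately show ?thesis using c by simp
qed

section \<open>Isotropy groups and commutators\<close>

lemma isotropyD:
  assumes "x \<in> isotropy G e"
  shows "x \<in> carrier G" "d x = e" "r x = e"
  using assms unfolding isotropy_def by auto

lemma group_isotropy_group:
  assumes e: "e \<in> identities G"
  shows "group (isotropy_group G e)"
proof (rule groupI)
  fix x assume "x \<in> carrier (isotropy_group G e)"
  then have "x \<in> isotropy G e" by (simp add: isotropy_group_def)
  then show "\<exists>y\<in>carrier (isotropy_group G e).
      y \<otimes>\<^bsub>isotropy_group G e\<^esub> x = \<one>\<^bsub>isotropy_group G e\<^esub>"
    by (intro bexI[of _ "iv x"]) (auto simp: isotropy_group_def isotropy_def)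
qed (use e in \<open>auto simp: isotropy_group_def isotropy_def\<close>)

lemma inv_isotropy_group:
  assumes e: "e \<in> identities G" and x: "x \<in> isotropy G e"
  shows "inv\<^bsub>isotropy_group G e\<^esub> x = iv x"
  using x by (intro group.inv_equality[OF group_isotropy_group[OF e]])
    (auto simp: isotropy_group_def isotropy_def)

lemma comm_group_isotropy_iff:
  assumes e: "e \<in> identities G"
  shows "comm_group (isotropy_group G e) \<longleftrightarrow>
    (\<forall>x\<in>isotropy G e. \<forall>y\<in>isotropy G e. x \<cdot> y = y \<cdot> x)"
proof
  assume "comm_group (isotropy_group G e)"
  then interpret comm_group "isotropy_group G e" .
  show "\<forall>x\<in>isotropy G e. \<forall>y\<in>isotropy G e. x \<cdot> y = y \<cdot> x"
    using m_comm by (simp add: isotropy_group_def)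
next
  assume "\<forall>x\<in>isotropy G e. \<forall>y\<in>isotropy G e. x \<cdot> y = y \<cdot> x"
  then show "comm_group (isotropy_group G e)"
    by (intro group.group_comm_groupI[OF group_isotropy_group[OF e]])
      (auto simp: isotropy_group_def)
qed

lemma commutator_in_isotropy:
  assumes "x \<in> isotropy G e" "y \<in> isotropy G e"
  shows "commutator G x y \<in> isotropy G e"
  using assms by (simp add: commutator_def isotropy_def)

text \<open>This form matches the coset criterion: a commutator in \<open>G'\<close> says that
  \<open>x \<cdot> y\<close> and \<open>y \<cdot> x\<close> lie in one coset.\<close>

lemma commutator_swap_eq:
  assumes "x \<in> isotropy G e" "y \<in> isotropy G e"
  shows "commutator G x y = iv (y \<cdot> x) \<cdot> (x \<cdot> y)"
  using assms by (simp add: commutator_def isotropy_def)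

lemma commutator_identity_iff:
  assumes x: "x \<in> isotropy G e" and y: "y \<in> isotropy G e"
  shows "commutator G x y \<in> identities G \<longleftrightarrow> x \<cdot> y = y \<cdot> x"
proof
  assume "commutator G x y \<in> identities G"
  then have "iv (y \<cdot> x) \<cdot> (x \<cdot> y) \<in> identities G" by (simp only: commutator_swap_eq[OF x y])
  moreover have "x \<cdot> y \<in> carrier G" "y \<cdot> x \<in> carrier G" "r (x \<cdot> y) = r (y \<cdot> x)"
    using x y by (simp_all add: isotropy_def)
  ultimately show "x \<cdot> y = y \<cdot> x" using eq_if_ginv_prd_identity by blast
next
  assume "x \<cdot> y = y \<cdot> x"
  then have "commutator G x y = iv (y \<cdot> x) \<cdot> (y \<cdot> x)" by (simp only: commutator_swap_eq[OF x y])
  moreover have "y \<cdot> x \<in> carrier G" using x y by (simp add: isotropy_def)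
  ultimately show "commutator G x y \<in> identities G" by (simp only: ginv_prd_self dom_in_identities)
qed

lemma commutator_self_identity: "e \<in> identities G \<Longrightarrow> commutator G e e = e"
  by (simp add: commutator_def)

lemma identity_in_isotropy: "e \<in> identities G \<Longrightarrow> e \<in> isotropy G e"
  by (simp add: isotropy_def)

text \<open>Conjugation by \<open>g\<close> is multiplicative from the isotropy at
  \<open>r g\<close> to the isotropy at \<open>d g\<close>, since each inner
  \<open>g \<cdot> iv g\<close> cancels. Normality of \<open>G'\<close> comes from this.\<close>

lemma conj_commutator:
  assumes x: "x \<in> isotropy G e" and y: "y \<in> isotropy G e" and g: "g \<in> carrier G" "r g = e"
  shows "iv g \<cdot> commutator G x y \<cdot> g = commutator G (iv g \<cdot> x \<cdot> g) (iv g \<cdot> y \<cdot> g)"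
  using assms by (simp add: commutator_def isotropy_def)

section \<open>Subgroupoids\<close>

lemma subgroupoidD:
  assumes "subgroupoid K G"
  shows "K \<noteq> {}" "g \<in> K \<Longrightarrow> g \<in> carrier G" "g \<in> K \<Longrightarrow> iv g \<in> K"
    "\<lbrakk>g \<in> K; h \<in> K; d g = r h\<rbrakk> \<Longrightarrow> g \<cdot> h \<in> K"
  using assms unfolding subgroupoid_def defined_iff by blast+

lemma subgroupoid_dom: "\<lbrakk>subgroupoid K G; g \<in> K\<rbrakk> \<Longrightarrow> d g \<in> K"
  using subgroupoidD(2-4) by (metis dom_ginv ginv_prd_self)

lemma subgroupoid_ran: "\<lbrakk>subgroupoid K G; g \<in> K\<rbrakk> \<Longrightarrow> r g \<in> K"
  using subgroupoidD(3) subgroupoid_dom subgroupoidD(2) dom_ginv by metis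

section \<open>Restricted structures and wide subgroupoids\<close>

lemma restr_simps:
  assumes "g \<in> K" "h \<in> K"
  shows "defined (restr G K) g h \<longleftrightarrow> defined G g h" "prd (restr G K) g h = g \<cdot> h"
  using assms by (simp_all add: restr_def defined_def prd_def)

text \<open>A subgroupoid contains \<open>d e\<close> along with \<open>e\<close>. So an element
  that is a unit within \<open>K\<close> can be tested against \<open>d e\<close>, and this one test
  forces \<open>d e = e\<close>, making it an identity of all of \<open>G\<close>.\<close>

lemma wide_subgroupoid_iff: "wide_subgroupoid K G \<longleftrightarrow> subgroupoid K G \<and> identities G \<subseteq> K"
proof -
  have "identities (restr G K) = identities G \<inter> K" if K: "subgroupoid K G"
  proof (intro equalityI subsetI)
    fix e assume e: "e \<in> identities (restr G K)"
    then have eK: "e \<in> K" by (simp add: identities_def restr_def)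
    have c: "e \<in> carrier G" "d e \<in> K"
      using subgroupoidD(2)[OF K eK] subgroupoid_dom[OF K eK] .
    have "defined (restr G K) e (d e) \<longrightarrow> prd (restr G K) e (d e) = d e"
      using e c(2) unfolding identities_def by (simp add: restr_def)
    then have "e \<cdot> d e = d e" using dom_id_props(2)[OF c(1)] by (simp only: restr_simps[OF eK c(2)])
    then have "d e = e" using prd_dom_id[OF c(1)] by (rule trans[OF sym])
    with eK c(1) show "e \<in> identities G \<inter> K" using identities_iff by blast
  next
    fix e assume e: "e \<in> identities G \<inter> K"
    then have eK: "e \<in> K" and ei: "\<And>g. g \<in> carrier G \<Longrightarrow> defined G e g \<Longrightarrow> e \<cdot> g = g"
      "\<And>g. g \<in> carrier G \<Longrightarrow> defined G g e \<Longrightarrow> g \<cdot> e = g"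
      unfolding identities_def by blast+
    have "prd (restr G K) e g = g" if "g \<in> K" "defined (restr G K) e g" for g
      using that(2) ei(1)[OF subgroupoidD(2)[OF K that(1)]] by (simp only: restr_simps[OF eK that(1)])
    moreover have "prd (restr G K) g e = g" if "g \<in> K" "defined (restr G K) g e" for g
      using that(2) ei(2)[OF subgroupoidD(2)[OF K that(1)]] by (simp only: restr_simps[OF that(1) eK])
    moreover have "carrier (restr G K) = K" by (simp add: restr_def)
    ultimately show "e \<in> identities (restr G K)"
      using eK unfolding identities_def[of "restr G K"] by blast
  qed
  then show ?thesis unfolding wide_subgroupoid_def by blast
qed

lemma dom_id_restr:
  assumes K: "subgroupoid K G" and g: "g \<in> K"
  shows "dom_id (restr G K) g = d g"
  unfolding dom_id_def[of "restr G K"]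
proof (rule the_equality)
  show "d g \<in> carrier (restr G K) \<and> defined (restr G K) g (d g) \<and> prd (restr G K) g (d g) = g"
    using K g subgroupoid_dom[OF K g] subgroupoidD(2)[OF K g]
    by (simp add: restr_simps defined_iff) (simp add: restr_def)
next
  fix e assume e: "e \<in> carrier (restr G K) \<and> defined (restr G K) g e \<and> prd (restr G K) g e = g"
  then have "e \<in> K" by (simp add: restr_def)
  with e g subgroupoidD(2)[OF K g] show "e = d g" using dom_id_unique by (auto simp: restr_simps)
qed

lemma ran_id_restr:
  assumes K: "subgroupoid K G" and g: "g \<in> K"
  shows "ran_id (restr G K) g = r g"
  unfolding ran_id_def[of "restr G K"]
proof (rule the_equality)
  show "r g \<in> carrier (restr G K) \<and> defined (restr G K) (r g) g \<and> prd (restr G K) (r g) g = g"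
    using K g subgroupoid_ran[OF K g] subgroupoidD(2)[OF K g]
    by (simp add: restr_simps defined_iff) (simp add: restr_def)
next
  fix e assume e: "e \<in> carrier (restr G K) \<and> defined (restr G K) e g \<and> prd (restr G K) e g = g"
  then have "e \<in> K" by (simp add: restr_def)
  with e g subgroupoidD(2)[OF K g] show "e = r g" using ran_id_unique by (auto simp: restr_simps)
qed

text \<open>Being a definite description over the structure, \<open>ginv\<close> has to be
  recomputed in \<open>restr G K\<close>. The only candidate is the inverse in \<open>G\<close>, and
  \<open>K\<close> contains it.\<close>

lemma ginv_restr:
  assumes K: "subgroupoid K G" and g: "g \<in> K"
  shows "ginv (restr G K) g = iv g"
proof -
  have "is_ginv (restr G K) g h \<longleftrightarrow> h \<in> K \<and> is_ginv G g h" for h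
    using g subgroupoidD(2)[OF K] unfolding is_ginv_def dom_id_restr[OF K g] ran_id_restr[OF K g]
    by (cases "h \<in> K") (auto simp: restr_simps, auto simp: restr_def)
  then have "is_ginv (restr G K) g h \<longleftrightarrow> h = iv g" for h
    using g subgroupoidD(2,3)[OF K] ginv_eqI ginv_is_ginv by metis
  then show ?thesis unfolding ginv_def[of "restr G K"] by (intro the_equality) simp_all
qed

lemma subgroupoid_restr:
  assumes K: "subgroupoid K G" and S: "subgroupoid S G" and SK: "S \<subseteq> K"
  shows "subgroupoid S (restr G K)"
  unfolding subgroupoid_def
proof (intro conjI ballI impI)
  show "S \<noteq> {}" using S by (rule subgroupoidD)
  show "S \<subseteq> carrier (restr G K)" using SK by (simp add: restr_def)
next
  fix g assume "g \<in> S"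
  with S SK show "ginv (restr G K) g \<in> S" using ginv_restr[OF K] subgroupoidD(3) by auto
next
  fix g h assume "g \<in> S" "h \<in> S" "defined (restr G K) g h"
  then show "prd (restr G K) g h \<in> S"
    using S SK subsetD[OF SK] by (simp add: restr_simps subgroupoid_def)
qed

lemma subgroupoid_carrier: "carrier G \<noteq> {} \<Longrightarrow> subgroupoid (carrier G) G"
  unfolding subgroupoid_def defined_iff by auto

section \<open>Generated subgroupoids\<close>

lemma gen_subgroupoid_least: "\<lbrakk>subgroupoid K G; B \<subseteq> K\<rbrakk> \<Longrightarrow> gen_subgroupoid G B \<subseteq> K"
  unfolding gen_subgroupoid_def by blast

lemma gen_subgroupoid_incl: "B \<subseteq> gen_subgroupoid G B"
  unfolding gen_subgroupoid_def by blast

text \<open>The carrier is one member of the intersected family and bounds the intersection;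
  \<open>B\<close> keeps it nonempty; closure is inherited from the members.\<close>

lemma subgroupoid_gen_subgroupoid:
  assumes "B \<noteq> {}" "B \<subseteq> carrier G"
  shows "subgroupoid (gen_subgroupoid G B) G"
proof -
  have "gen_subgroupoid G B \<subseteq> carrier G"
    using assms by (intro gen_subgroupoid_least subgroupoid_carrier) auto
  moreover have "gen_subgroupoid G B \<noteq> {}" using assms(1) gen_subgroupoid_incl by blast
  ultimately show ?thesis unfolding subgroupoid_def gen_subgroupoid_def by auto
qed

text \<open>With \<open>x\<close> in \<open>H\<close>, \<open>[x,y]\<close> is \<open>iv x\<close>
  times the conjugate of \<open>x\<close> by \<open>y\<close>, and normality puts that conjugate
  into \<open>H\<close>.\<close>

lemma mutual_commutator_subset_normal:
  assumes H: "normal_subgroupoid H G"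
  shows "subgroupoid (mutual_commutator G H (carrier G)) (restr G H)"
proof -
  have sH: "subgroupoid H G" and iH: "identities G \<subseteq> H"
    using H by (auto simp: normal_subgroupoid_def wide_subgroupoid_iff)
  let ?B = "{commutator G x y | x y e.
    e \<in> identities G \<and> x \<in> H \<inter> isotropy G e \<and> y \<in> carrier G \<inter> isotropy G e}"
  obtain h where "h \<in> H" using subgroupoidD(1)[OF sH] by auto
  then have h: "h \<in> carrier G" using subgroupoidD(2)[OF sH] by auto
  have "d h \<in> identities G" "d h \<in> isotropy G (d h)" "d h \<in> H" "d h \<in> carrier G"
    using h iH identity_in_isotropy by auto
  \<comment> \<open>The commutator of \<open>d h\<close> with itself is a member.\<close>
  then have ne: "?B \<noteq> {}" by blast
  have BH: "?B \<subseteq> H"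
  proof clarify
    fix x y e assume e: "e \<in> identities G" and x: "x \<in> H" "x \<in> isotropy G e" and y: "y \<in> isotropy G e"
    have "iv y \<cdot> x \<cdot> y \<in> conj_set G H y" using x y
      unfolding conj_set_def by (intro CollectI exI[of _ x]) (simp add: isotropy_def)
    then have yxy: "iv y \<cdot> x \<cdot> y \<in> H" using H y by (auto simp: normal_subgroupoid_def isotropy_def)
    have "commutator G x y = iv x \<cdot> (iv y \<cdot> x \<cdot> y)" using x y by (simp add: commutator_def isotropy_def)
    then show "commutator G x y \<in> H"
      using x y yxy by (simp add: subgroupoidD(3,4)[OF sH] isotropy_def)
  qed
  have "subgroupoid (gen_subgroupoid G ?B) G"
    using ne BH subgroupoidD(2)[OF sH] by (intro subgroupoid_gen_subgroupoid) blast+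
  moreover have "gen_subgroupoid G ?B \<subseteq> H" using sH BH by (rule gen_subgroupoid_least)
  ultimately show ?thesis unfolding mutual_commutator_def using subgroupoid_restr[OF sH] by blast
qed

section \<open>The commutator subgroupoid\<close>

abbreviation "G' \<equiv> commutator_subgroupoid G"

lemma commutator_subgroupoid_least:
  assumes "subgroupoid K G"
    and "\<And>e x y. \<lbrakk>e \<in> identities G; x \<in> isotropy G e; y \<in> isotropy G e\<rbrakk> \<Longrightarrow> commutator G x y \<in> K"
  shows "G' \<subseteq> K"
  using assms unfolding commutator_subgroupoid_def by (intro gen_subgroupoid_least) auto

lemma commutator_in_commutator_subgroupoid:
  assumes "x \<in> isotropy G e" "y \<in> isotropy G e"
  shows "commutator G x y \<in> G'"
proof -
  have "e \<in> identities G" using assms dom_in_identities by (metis isotropyD(1,2))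
  then show ?thesis
    using assms unfolding commutator_subgroupoid_def by (intro subsetD[OF gen_subgroupoid_incl]) blast
qed

lemma identities_subset_commutator_subgroupoid: "identities G \<subseteq> G'"
  using commutator_in_commutator_subgroupoid commutator_self_identity identity_in_isotropy
  by (metis subsetI)

lemma subgroupoid_commutator_subgroupoid:
  assumes "carrier G \<noteq> {}"
  shows "subgroupoid G' G"
  unfolding commutator_subgroupoid_def
proof (rule subgroupoid_gen_subgroupoid)
  obtain g where "g \<in> carrier G" using assms by blast
  then have "d g \<in> identities G" by simp
  then show "{commutator G x y |x y e. e \<in> identities G \<and> x \<in> isotropy G e \<and> y \<in> isotropy G e} \<noteq> {}"
    using identity_in_isotropy by blast
  show "{commutator G x y |x y e. e \<in> identities G \<and> x \<in> isotropy G e \<and> y \<in> isotropy G e} \<subseteq> carrier G"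
    using commutator_in_isotropy isotropyD(1) by blast
qed

lemma derived_subset_isotropy:
  assumes "e \<in> identities G"
  shows "derived (isotropy_group G e) (carrier (isotropy_group G e)) \<subseteq> isotropy G e"
  using group.derived_in_carrier[OF group_isotropy_group[OF assms], of "isotropy G e"]
  by (simp add: isotropy_group_def)

text \<open>The union of the derived groups is a subgroupoid because composable isotropy elements
  share their base point. The other inclusion is an induction over the words generated by the
  commutators at one base point.\<close>

lemma commutator_subgroupoid_eq_derived:
  assumes ne: "carrier G \<noteq> {}"
  shows "G' = (\<Union>e\<in>identities G. derived (isotropy_group G e) (carrier (isotropy_group G e)))"
proof
  let ?D = "\<lambda>e. derived (isotropy_group G e) (carrier (isotropy_group G e))"
  note Dsub = derived_subset_isotropy
  have Dsubgroup: "subgroup (?D e) (isotropy_group G e)" if "e \<in> identities G" for e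
    using group.derived_is_subgroup[OF group_isotropy_group[OF that]] by simp
  \<comment> \<open>\<open>derived_set\<close> uses commutators \<open>x y x^-1 y^-1\<close>, while
    \<open>commutator\<close> is \<open>x^-1 y^-1 x y\<close>. Replacing \<open>x\<close> and
    \<open>y\<close> by their inverses exchanges the two conventions.\<close>
  have dset: "derived_set (isotropy_group G e) (carrier (isotropy_group G e)) =
      {commutator G x y | x y. x \<in> isotropy G e \<and> y \<in> isotropy G e}" (is "?L = ?R")
    if e: "e \<in> identities G" for e
  proof (intro equalityI subsetI)
    fix z assume "z \<in> ?L"
    then obtain x y where xy: "x \<in> isotropy G e" "y \<in> isotropy G e" and "z = x \<cdot> y \<cdot> iv x \<cdot> iv y"
      by (auto simp: isotropy_group_def inv_isotropy_group[OF e, unfolded isotropy_group_def])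
    then have "z = commutator G (iv x) (iv y)" using xy by (simp add: commutator_def isotropy_def)
    moreover have "iv x \<in> isotropy G e" "iv y \<in> isotropy G e" using xy by (auto simp: isotropy_def)
    ultimately show "z \<in> ?R" by blast
  next
    fix z assume "z \<in> ?R"
    then obtain x y where xy: "x \<in> isotropy G e" "y \<in> isotropy G e" and z: "z = commutator G x y"
      by auto
    have i: "iv x \<in> isotropy G e" "iv y \<in> isotropy G e" using xy by (auto simp: isotropy_def)
    have "z = iv x \<cdot> iv y \<cdot> iv (iv x) \<cdot> iv (iv y)" using xy z by (simp add: commutator_def isotropy_def)
    then show "z \<in> ?L" using i
      by (force simp: isotropy_group_def inv_isotropy_group[OF e, unfolded isotropy_group_def])
  qed
  show "G' \<subseteq> (\<Union>e\<in>identities G. ?D e)"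
  proof (rule commutator_subgroupoid_least)
    show "subgroupoid (\<Union>e\<in>identities G. ?D e) G"
      unfolding subgroupoid_def
    proof (intro conjI ballI impI)
      obtain g where "g \<in> carrier G" using ne by blast
      then have "d g \<in> identities G" by simp
      then show "(\<Union>e\<in>identities G. ?D e) \<noteq> {}" using subgroup.one_closed[OF Dsubgroup] by blast
      show "(\<Union>e\<in>identities G. ?D e) \<subseteq> carrier G" using Dsub isotropyD(1) by blast
    next
      fix g assume "g \<in> (\<Union>e\<in>identities G. ?D e)"
      then obtain e where e: "e \<in> identities G" "g \<in> ?D e" by blast
      then have "iv g \<in> ?D e"
        using subgroup.m_inv_closed[OF Dsubgroup] Dsub inv_isotropy_group by fastforce
      with e show "iv g \<in> (\<Union>e\<in>identities G. ?D e)" by blast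
    next
      fix g h assume "g \<in> (\<Union>e\<in>identities G. ?D e)" "h \<in> (\<Union>e\<in>identities G. ?D e)"
        and gh: "defined G g h"
      then obtain e f where e: "e \<in> identities G" "g \<in> ?D e" and f: "f \<in> identities G" "h \<in> ?D f"
        by blast
      have "d g = e" "r h = f" using e f Dsub isotropyD(2,3) by blast+
      then have "f = e" using gh by (simp add: defined_iff)
      then have "g \<cdot> h \<in> ?D e"
        using subgroup.m_closed[OF Dsubgroup[OF e(1)], of g h] e f by (simp add: isotropy_group_def)
      with e show "g \<cdot> h \<in> (\<Union>e\<in>identities G. ?D e)" by blast
    qed
  next
    fix e x y assume "e \<in> identities G" "x \<in> isotropy G e" "y \<in> isotropy G e"
    then show "commutator G x y \<in> (\<Union>e\<in>identities G. ?D e)"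
      unfolding derived_def by (auto simp: dset intro!: bexI[of _ e] generate.incl)
  qed
  show "(\<Union>e\<in>identities G. ?D e) \<subseteq> G'"
  proof (rule UN_least)
    fix e assume e: "e \<in> identities G"
    note sG = subgroupoid_commutator_subgroupoid[OF ne]
    show "?D e \<subseteq> G'"
    proof
      fix z assume "z \<in> ?D e"
      then have "z \<in> generate (isotropy_group G e)
          {commutator G x y | x y. x \<in> isotropy G e \<and> y \<in> isotropy G e}"
        by (simp add: derived_def dset[OF e])
      \<comment> \<open>Membership in the isotropy is carried through the induction because
        \<open>G'\<close> is closed only under products that are defined.\<close>
      then have "z \<in> G' \<inter> isotropy G e"
      proof (induction rule: generate.induct)
        case one
        then show ?case
          using e identities_subset_commutator_subgroupoid by (auto simp: isotropy_group_def isotropy_def)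
      next
        case (incl h)
        then show ?case using commutator_in_commutator_subgroupoid commutator_in_isotropy by auto
      next
        case (inv h)
        then have h: "h \<in> G'" "h \<in> isotropy G e"
          using commutator_in_commutator_subgroupoid commutator_in_isotropy by auto
        then show ?case
          using subgroupoidD(3)[OF sG] by (auto simp: inv_isotropy_group[OF e]) (auto simp: isotropy_def)
      next
        case (eng h1 h2)
        then show ?case
          using subgroupoidD(4)[OF sG, of h1 h2] by (auto simp: isotropy_group_def isotropy_def)
      qed
      then show "z \<in> G'" by blast
    qed
  qed
qed

lemma disjoint_derived_isotropy:
  "disjoint_family_on
    (\<lambda>e. derived (isotropy_group G e) (carrier (isotropy_group G e))) (identities G)"
proof -
  have "isotropy G e \<inter> isotropy G f = {}" if "e \<noteq> f" for e f
    using that by (auto simp: isotropy_def)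
  then show ?thesis unfolding disjoint_family_on_def using derived_subset_isotropy by blast
qed

text \<open>
  The isotropy elements all of whose conjugates, at every base point, lie in \<open>G'\<close> form a subgroupoid
  containing the commutators.
\<close>
lemma
  assumes ne: "carrier G \<noteq> {}"
  shows commutator_subgroupoid_isotropy: "n \<in> G' \<Longrightarrow> d n = r n"
    and normal_commutator_subgroupoid: "normal_subgroupoid G' G"
proof -
  note sG = subgroupoid_commutator_subgroupoid[OF ne]
  define K where "K = {k \<in> carrier G. d k = r k \<and>
    (\<forall>g\<in>carrier G. r g = r k \<longrightarrow> iv g \<cdot> k \<cdot> g \<in> G')}"
  have GK: "G' \<subseteq> K"
  proof (rule commutator_subgroupoid_least)
    show "subgroupoid K G"
      unfolding subgroupoid_def
    proof (intro conjI ballI impI)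
      obtain g where g: "g \<in> carrier G" using ne by blast
      have "d g \<in> K"
        using g identities_subset_commutator_subgroupoid by (auto simp: K_def)
      then show "K \<noteq> {}" by blast
      show "K \<subseteq> carrier G" by (auto simp: K_def)
    next
      fix k assume "k \<in> K"
      then have k: "k \<in> carrier G" "d k = r k"
        and kc: "\<And>g. \<lbrakk>g \<in> carrier G; r g = r k\<rbrakk> \<Longrightarrow> iv g \<cdot> k \<cdot> g \<in> G'"
        by (auto simp: K_def)
      have "iv g \<cdot> iv k \<cdot> g \<in> G'" if "g \<in> carrier G" "r g = r k" for g
        using subgroupoidD(3)[OF sG kc[OF that]] that k by simp
      then show "iv k \<in> K" using k by (simp add: K_def)
    next
      fix k l assume "k \<in> K" "l \<in> K" "defined G k l"
      \<comment> \<open>As \<open>k\<close> and \<open>l\<close> are composable isotropy elements,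
        they have the same base point, so one and the same \<open>g\<close> conjugates both and the
        conjugate of the product is the product of the conjugates.\<close>
      then have k: "k \<in> carrier G" "d k = r k" and l: "l \<in> carrier G" "d l = r k" "r l = r k"
        and kc: "\<And>g. \<lbrakk>g \<in> carrier G; r g = r k\<rbrakk> \<Longrightarrow> iv g \<cdot> k \<cdot> g \<in> G'"
        and lc: "\<And>g. \<lbrakk>g \<in> carrier G; r g = r k\<rbrakk> \<Longrightarrow> iv g \<cdot> l \<cdot> g \<in> G'"
        by (auto simp: K_def defined_iff)
      have "iv g \<cdot> (k \<cdot> l) \<cdot> g \<in> G'" if "g \<in> carrier G" "r g = r k" for g
        using subgroupoidD(4)[OF sG kc[OF that] lc[OF that]] that k l by simp
      then show "k \<cdot> l \<in> K" using k l by (simp add: K_def)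
    qed
  next
    fix e x y assume xy: "x \<in> isotropy G e" "y \<in> isotropy G e"
    have "iv g \<cdot> commutator G x y \<cdot> g \<in> G'" if g: "g \<in> carrier G" "r g = e" for g
      unfolding conj_commutator[OF xy g] using xy g
      by (intro commutator_in_commutator_subgroupoid[of _ "d g"]) (simp_all add: isotropy_def)
    then show "commutator G x y \<in> K"
      using isotropyD[OF commutator_in_isotropy[OF xy]] by (simp add: K_def)
  qed
  then show "d n = r n" if "n \<in> G'" using that by (auto simp: K_def)
  show "normal_subgroupoid G' G"
    unfolding normal_subgroupoid_def wide_subgroupoid_iff
  proof (intro conjI ballI sG identities_subset_commutator_subgroupoid, rule subsetI)
    fix g z assume g: "g \<in> carrier G" and "z \<in> conj_set G G' g"
    then obtain n where n: "z = iv g \<cdot> n \<cdot> g" "n \<in> G'" "r n = r g" by (auto simp: conj_set_def)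
    then have "n \<in> K" using GK by blast
    with g n show "z \<in> G'" by (simp only: K_def mem_Collect_eq)
  qed
qed

section \<open>Cosets and quotients\<close>

text \<open>Wideness gives \<open>d g \<in> H\<close>, so \<open>g\<close> lies in its own coset;
  conversely \<open>a \<cdot> h = b \<cdot> (iv b \<cdot> a \<cdot> h)\<close>. The clause
  \<open>r g = r l\<close> expresses that \<open>iv l\<close> and \<open>g\<close> compose.\<close>

lemma left_coset_eq_iff:
  assumes H: "wide_subgroupoid H G" and g: "g \<in> carrier G" and l: "l \<in> carrier G"
  shows "left_coset G H g = left_coset G H l \<longleftrightarrow> r g = r l \<and> iv l \<cdot> g \<in> H"
proof
  have sH: "subgroupoid H G" and iH: "identities G \<subseteq> H" using H by (auto simp: wide_subgroupoid_iff)
  assume eq: "left_coset G H g = left_coset G H l"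
  have "d g \<in> H" "r (d g) = d g" "g \<cdot> d g = g" using g iH by auto
  then have "g \<in> left_coset G H g" unfolding left_coset_def by force
  then have "g \<in> left_coset G H l" by (simp only: eq)
  then obtain h where h: "g = l \<cdot> h" "h \<in> H" "r h = d l" unfolding left_coset_def by blast
  then show "r g = r l \<and> iv l \<cdot> g \<in> H" using l subgroupoidD(2)[OF sH h(2)] by simp
next
  have sH: "subgroupoid H G" using H by (simp add: wide_subgroupoid_iff)
  have *: "left_coset G H a \<subseteq> left_coset G H b"
    if a: "a \<in> carrier G" and b: "b \<in> carrier G" and "r a = r b" and "iv b \<cdot> a \<in> H" for a b
  proof
    fix x assume "x \<in> left_coset G H a"
    then obtain h where h: "x = a \<cdot> h" "h \<in> H" "r h = d a" by (auto simp: left_coset_def)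
    note hc = subgroupoidD(2)[OF sH h(2)]
    have "x = b \<cdot> (iv b \<cdot> a \<cdot> h)" using h hc that by simp
    moreover have "iv b \<cdot> a \<cdot> h \<in> H" using h that by (intro subgroupoidD(4)[OF sH \<open>iv b \<cdot> a \<in> H\<close>]) simp_all
    moreover have "r (iv b \<cdot> a \<cdot> h) = d b" using h hc that by simp
    ultimately show "x \<in> left_coset G H b" unfolding left_coset_def by blast
  qed
  assume a: "r g = r l \<and> iv l \<cdot> g \<in> H"
  then have "iv g \<cdot> l \<in> H" using subgroupoidD(3)[OF sH, of "iv l \<cdot> g"] g l by simp
  with a show "left_coset G H g = left_coset G H l" using * g l by (metis subset_antisym)
qed

text \<open>The quotient of the two products factors as \<open>(iv l' \<cdot> l) \<cdot> (iv l
  \<cdot> (iv g' \<cdot> g) \<cdot> l)\<close>, an element of \<open>H\<close> times a conjugate of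
  an element of \<open>H\<close>.\<close>

lemma left_coset_prd_cong:
  assumes H: "normal_subgroupoid H G"
    and c: "g \<in> carrier G" "l \<in> carrier G" "g' \<in> carrier G" "l' \<in> carrier G"
    and gl: "d g = r l" "d g' = r l'"
    and eq: "left_coset G H g = left_coset G H g'" "left_coset G H l = left_coset G H l'"
  shows "left_coset G H (g \<cdot> l) = left_coset G H (g' \<cdot> l')"
proof -
  have w: "wide_subgroupoid H G" and sH: "subgroupoid H G"
    using H by (auto simp: normal_subgroupoid_def wide_subgroupoid_iff)
  have g: "r g = r g'" "iv g' \<cdot> g \<in> H" and l: "r l = r l'" "iv l' \<cdot> l \<in> H"
    using eq left_coset_eq_iff[OF w] c by auto
  \<comment> \<open>Here \<open>iv g' \<cdot> g\<close> has domain \<open>d g = r l\<close> and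
    range \<open>d g' = r l' = r l\<close>, so it is an isotropy element at the range of
    \<open>l\<close>, as \<open>conj_set\<close> demands.\<close>
  have "iv l \<cdot> (iv g' \<cdot> g) \<cdot> l \<in> conj_set G H l"
    using c gl g l unfolding conj_set_def by fastforce
  then have conj: "iv l \<cdot> (iv g' \<cdot> g) \<cdot> l \<in> H" using H c by (auto simp: normal_subgroupoid_def)
  have "(iv l' \<cdot> l) \<cdot> (iv l \<cdot> (iv g' \<cdot> g) \<cdot> l) \<in> H"
    using c gl g l by (intro subgroupoidD(4)[OF sH l(2) conj]) simp_all
  moreover have "(iv l' \<cdot> l) \<cdot> (iv l \<cdot> (iv g' \<cdot> g) \<cdot> l) = iv (g' \<cdot> l') \<cdot> (g \<cdot> l)"
    using c gl g l by simp
  moreover have "g \<cdot> l \<in> carrier G" "g' \<cdot> l' \<in> carrier G" "r (g \<cdot> l) = r (g' \<cdot> l')"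
    using c gl g(1) by simp_all
  ultimately show ?thesis by (simp only: left_coset_eq_iff[OF w])
qed

section \<open>Multiplication of cosets\<close>

lemma quotient_defined_iff:
  "defined (quotient_groupoid G H) X Y \<longleftrightarrow> (\<exists>g\<in>carrier G. \<exists>l\<in>carrier G.
    X = left_coset G H g \<and> Y = left_coset G H l \<and> defined G g l)"
proof -
  have "(if P then Some z else None) \<noteq> None \<longleftrightarrow> P" for P and z :: "'a set" by simp
  then show ?thesis
    unfolding defined_def[of "quotient_groupoid G H"]
    by (simp only: quotient_groupoid_def partial_magma.select_convs)
qed

lemma quotient_prd:
  assumes H: "normal_subgroupoid H G" and c: "g \<in> carrier G" "l \<in> carrier G" "d g = r l"
  shows "defined (quotient_groupoid G H) (left_coset G H g) (left_coset G H l)"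
    and "prd (quotient_groupoid G H) (left_coset G H g) (left_coset G H l) = left_coset G H (g \<cdot> l)"
proof -
  let ?P = "\<lambda>Z. \<exists>g'\<in>carrier G. \<exists>l'\<in>carrier G. left_coset G H g = left_coset G H g' \<and>
    left_coset G H l = left_coset G H l' \<and> defined G g' l' \<and> Z = left_coset G H (g' \<cdot> l')"
  have the: "(THE Z. ?P Z) = left_coset G H (g \<cdot> l)"
  proof (rule the_equality)
    show "?P (left_coset G H (g \<cdot> l))"
      using c by (intro bexI[of _ g] bexI[of _ l]) (simp_all add: defined_iff)
  next
    fix Z assume "?P Z"
    then obtain g' l' where g': "g' \<in> carrier G" "l' \<in> carrier G" "d g' = r l'"
      "left_coset G H g = left_coset G H g'" "left_coset G H l = left_coset G H l'"
      and Z: "Z = left_coset G H (g' \<cdot> l')"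
      unfolding defined_iff by blast
    show "Z = left_coset G H (g \<cdot> l)"
      unfolding Z by (rule left_coset_prd_cong[OF H c(1,2) g'(1,2) c(3) g'(3-5), symmetric])
  qed
  have ex: "\<exists>g'\<in>carrier G. \<exists>l'\<in>carrier G. left_coset G H g = left_coset G H g' \<and>
    left_coset G H l = left_coset G H l' \<and> defined G g' l'"
    using c by (intro bexI[of _ g] bexI[of _ l]) (simp_all add: defined_iff)
  have "pmult (quotient_groupoid G H) (left_coset G H g) (left_coset G H l) =
      Some (left_coset G H (g \<cdot> l))"
    unfolding quotient_groupoid_def by (simp only: partial_magma.select_convs if_P[OF ex] the)
  then show "defined (quotient_groupoid G H) (left_coset G H g) (left_coset G H l)"
    and "prd (quotient_groupoid G H) (left_coset G H g) (left_coset G H l) = left_coset G H (g \<cdot> l)"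
    unfolding defined_def prd_def by simp_all
qed

lemma left_coset_hom:
  assumes "normal_subgroupoid H G"
  shows "left_coset G H \<in> groupoid_hom G (quotient_groupoid G H)"
  using quotient_prd[OF assms] unfolding groupoid_hom_def
  by (auto simp: defined_iff) (auto simp: quotient_groupoid_def)

text \<open>
  A surjective image is again a groupoid as soon as it identifies only elements with the same
  composability.
\<close>
lemma groupoid_image:
  fixes Q :: "('c, 'n) partial_magma_scheme" and q :: "'a \<Rightarrow> 'c"
  assumes car: "carrier Q = q ` carrier G"
    and cl: "\<And>X Y. defined Q X Y \<Longrightarrow> X \<in> carrier Q \<and> Y \<in> carrier Q"
    and df: "\<And>g l. \<lbrakk>g \<in> carrier G; l \<in> carrier G\<rbrakk> \<Longrightarrow> defined Q (q g) (q l) \<longleftrightarrow> d g = r l"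
    and pr: "\<And>g l. \<lbrakk>g \<in> carrier G; l \<in> carrier G; d g = r l\<rbrakk> \<Longrightarrow> prd Q (q g) (q l) = q (g \<cdot> l)"
  shows "groupoid Q"
proof -
  \<comment> \<open>Uniqueness of the right unit: any candidate is some \<open>q l\<close> with
    \<open>l\<close> composable after \<open>g\<close>, and multiplying
    \<open>q (g \<cdot> l) = q g\<close> by \<open>q (iv g)\<close> on the left cancels
    \<open>g\<close>.\<close>
  have dq: "e = q (d g)" if g: "g \<in> carrier G" and e: "e \<in> carrier Q" "defined Q (q g) e" "prd Q (q g) e = q g"
    for e g
  proof -
    obtain l where l: "l \<in> carrier G" "e = q l" using e car by auto
    then have gl: "d g = r l" using df g e by simp
    then have "q (g \<cdot> l) = q g" using e g l pr by simp
    then have "prd Q (q (iv g)) (q (g \<cdot> l)) = prd Q (q (iv g)) (q g)" by simp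
    then show "e = q (d g)" using g l gl by (simp add: pr)
  qed
  have rq: "e = q (r g)" if g: "g \<in> carrier G" and e: "e \<in> carrier Q" "defined Q e (q g)" "prd Q e (q g) = q g"
    for e g
  proof -
    obtain l where l: "l \<in> carrier G" "e = q l" using e car by auto
    then have lg: "d l = r g" using df g e by simp
    then have "q (l \<cdot> g) = q g" using e g l pr by simp
    then have "prd Q (q (l \<cdot> g)) (q (iv g)) = prd Q (q g) (q (iv g))" by simp
    then show "e = q (r g)" using g l lg by (simp add: pr)
  qed
  have du: "\<exists>!e. e \<in> carrier Q \<and> defined Q (q g) e \<and> prd Q (q g) e = q g" if "g \<in> carrier G" for g
    using that dq[OF that] by (intro ex1I[of _ "q (d g)"]) (auto simp: df pr car)
  have ru: "\<exists>!e. e \<in> carrier Q \<and> defined Q e (q g) \<and> prd Q e (q g) = q g" if "g \<in> carrier G" for g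
    using that rq[OF that] by (intro ex1I[of _ "q (r g)"]) (auto simp: df pr car)
  have dom: "dom_id Q (q g) = q (d g)" if "g \<in> carrier G" for g
    unfolding dom_id_def[of Q] using that
    by (intro the1_equality[OF du[OF that]]) (simp add: df pr car)
  have ran: "ran_id Q (q g) = q (r g)" if "g \<in> carrier G" for g
    unfolding ran_id_def[of Q] using that
    by (intro the1_equality[OF ru[OF that]]) (simp add: df pr car)
  show ?thesis
  proof
    fix X Y Z assume "pmult Q X Y = Some Z"
    then have XY: "defined Q X Y" "prd Q X Y = Z" by (auto simp: defined_def prd_def)
    then obtain g l where "g \<in> carrier G" "l \<in> carrier G" "X = q g" "Y = q l"
      using cl[of X Y] car by auto
    then show "X \<in> carrier Q \<and> Y \<in> carrier Q \<and> Z \<in> carrier Q"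
      using XY df pr by (auto simp: car)
  next
    fix X Y Z assume "X \<in> carrier Q" "Y \<in> carrier Q" "Z \<in> carrier Q"
    then obtain g h l where c: "g \<in> carrier G" "h \<in> carrier G" "l \<in> carrier G"
      and eq: "X = q g" "Y = q h" "Z = q l"
      using car by auto
    show "(defined Q Y Z \<and> defined Q X (prd Q Y Z)) \<longleftrightarrow> (defined Q X Y \<and> defined Q (prd Q X Y) Z)"
      "(defined Q Y Z \<and> defined Q X (prd Q Y Z)) \<longleftrightarrow> (defined Q X Y \<and> defined Q Y Z)"
      unfolding eq using c by (auto simp: df pr)
    assume "defined Q Y Z" "defined Q X (prd Q Y Z)"
    then show "prd Q X (prd Q Y Z) = prd Q (prd Q X Y) Z"
      unfolding eq using c by (auto simp: df pr)
  next
    fix X assume "X \<in> carrier Q"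
    then obtain g where g: "g \<in> carrier G" "X = q g" using car by auto
    show "\<exists>!e. e \<in> carrier Q \<and> defined Q X e \<and> prd Q X e = X"
      "\<exists>!e. e \<in> carrier Q \<and> defined Q e X \<and> prd Q e X = X"
      using du ru g by auto
    have "is_ginv Q X (q (iv g))"
      using g by (simp add: is_ginv_def dom ran df pr car)
    then show "\<exists>h. is_ginv Q X h" by blast
  qed
qed

end

section \<open>Homomorphisms into abelian groupoids\<close>

locale groupoid_morphism = G: groupoid G + A: groupoid A
  for G :: "('a, 'm) partial_magma_scheme" and A :: "('b, 'n) partial_magma_scheme" +
  fixes \<sigma>
  assumes hom: "\<sigma> \<in> groupoid_hom G A"
begin

lemma closed [simp]: "g \<in> carrier G \<Longrightarrow> \<sigma> g \<in> carrier A"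
  using hom unfolding groupoid_hom_def by blast

lemma map_defined:
  "\<lbrakk>g \<in> carrier G; h \<in> carrier G; dom_id G g = ran_id G h\<rbrakk> \<Longrightarrow> defined A (\<sigma> g) (\<sigma> h)"
  using hom unfolding groupoid_hom_def G.defined_iff by blast

lemma map_prd:
  "\<lbrakk>g \<in> carrier G; h \<in> carrier G; dom_id G g = ran_id G h\<rbrakk> \<Longrightarrow> \<sigma> (prd G g h) = prd A (\<sigma> g) (\<sigma> h)"
  using hom unfolding groupoid_hom_def G.defined_iff by blast

text \<open>The image of \<open>d g\<close> is a right unit of \<open>\<sigma> g\<close>, and right
  units are unique in \<open>A\<close>.\<close>

lemma map_dom: "g \<in> carrier G \<Longrightarrow> dom_id A (\<sigma> g) = \<sigma> (dom_id G g)"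
  using map_defined[of g "dom_id G g"] map_prd[of g "dom_id G g"]
  by (intro A.dom_id_unique) auto

lemma map_ran: "g \<in> carrier G \<Longrightarrow> ran_id A (\<sigma> g) = \<sigma> (ran_id G g)"
  using map_defined[of "ran_id G g" g] map_prd[of "ran_id G g" g]
  by (intro A.ran_id_unique) auto

lemma map_ginv:
  assumes g: "g \<in> carrier G"
  shows "\<sigma> (ginv G g) = ginv A (\<sigma> g)"
proof (rule A.ginv_eqI[symmetric])
  have "defined A (\<sigma> (ginv G g)) (\<sigma> g)" "defined A (\<sigma> g) (\<sigma> (ginv G g))"
    using g by (intro map_defined; simp)+
  moreover have "prd A (\<sigma> (ginv G g)) (\<sigma> g) = dom_id A (\<sigma> g)"
    using g by (simp add: map_dom map_prd[symmetric])
  moreover have "prd A (\<sigma> g) (\<sigma> (ginv G g)) = ran_id A (\<sigma> g)"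
    using g by (simp add: map_ran map_prd[symmetric])
  ultimately show "is_ginv A (\<sigma> g) (\<sigma> (ginv G g))"
    using g unfolding is_ginv_def by simp
qed (use g in simp)

lemma map_identities:
  assumes "e \<in> identities G"
  shows "\<sigma> e \<in> identities A"
  using A.dom_in_identities[of "\<sigma> e"] map_dom[of e] assms by simp

lemma map_isotropy:
  assumes "x \<in> isotropy G e"
  shows "\<sigma> x \<in> isotropy A (\<sigma> e)"
  using G.isotropyD[OF assms] map_dom[of x] map_ran[of x] closed[of x]
  unfolding isotropy_def[of A] by simp

lemma map_commutator:
  assumes "x \<in> isotropy G e" "y \<in> isotropy G e"
  shows "\<sigma> (commutator G x y) = commutator A (\<sigma> x) (\<sigma> y)"
  unfolding commutator_def using assms
  \<comment> \<open>With associativity switched off both sides keep the bracketing of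
    \<open>commutator\<close>, so \<open>map_prd\<close> can be applied factor by factor.\<close>
  by (simp add: isotropy_def map_prd map_ginv map_dom map_ran del: G.prd_assoc A.prd_assoc)

lemma commutator_subgroupoid_kernel:
  assumes ab: "abelian_groupoid A" and ne: "carrier G \<noteq> {}" and n: "n \<in> commutator_subgroupoid G"
  shows "\<sigma> n \<in> identities A"
proof -
  define K where "K = {k \<in> carrier G. dom_id G k = ran_id G k \<and> \<sigma> k \<in> identities A}"
  have "commutator_subgroupoid G \<subseteq> K"
  proof (rule G.commutator_subgroupoid_least)
    show "subgroupoid K G"
      unfolding subgroupoid_def
    proof (intro conjI ballI impI)
      obtain g where "g \<in> carrier G" using ne by blast
      then have "dom_id G g \<in> K" by (simp add: K_def map_identities)
      then show "K \<noteq> {}" by blast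
      show "K \<subseteq> carrier G" by (auto simp: K_def)
    next
      fix g assume "g \<in> K"
      then show "ginv G g \<in> K" by (simp add: K_def map_ginv)
    next
      fix g h assume gh: "g \<in> K" "h \<in> K" "defined G g h"
      then have c: "g \<in> carrier G" "h \<in> carrier G" "dom_id G g = ran_id G h"
        and i: "\<sigma> g \<in> identities A" "\<sigma> h \<in> identities A"
        by (auto simp: K_def G.defined_iff)
      \<comment> \<open>An identity is its own domain and range, so both images equal the image of
        \<open>d g = r h\<close>; the product is then an identity times itself.\<close>
      have "\<sigma> g = \<sigma> h" using i c map_dom[of g] map_ran[of h] by simp
      then have "\<sigma> (prd G g h) = \<sigma> h" using i c by (simp add: map_prd)
      then show "prd G g h \<in> K" using gh c by (simp add: K_def)
    qed
  next
    fix e x y assume e: "e \<in> identities G" and xy: "x \<in> isotropy G e" "y \<in> isotropy G e"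
    have "\<sigma> x \<in> isotropy A (\<sigma> e)" "\<sigma> y \<in> isotropy A (\<sigma> e)" using xy map_isotropy by auto
    moreover from this have "prd A (\<sigma> x) (\<sigma> y) = prd A (\<sigma> y) (\<sigma> x)"
      using ab map_identities[OF e] A.comm_group_isotropy_iff by (auto simp: abelian_groupoid_def)
    ultimately have "commutator A (\<sigma> x) (\<sigma> y) \<in> identities A"
      using A.commutator_identity_iff by blast
    then show "commutator G x y \<in> K"
      using G.isotropyD[OF G.commutator_in_isotropy[OF xy]] map_commutator[OF xy] by (simp add: K_def)
  qed
  with n show ?thesis by (auto simp: K_def)
qed

end

section \<open>Abelian groupoids, abelian quotients and the universal property of the quotient by
  \<open>G'\<close>\<close>

context groupoid
begin

lemma commutator_subgroupoid_trivial_iff: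
  assumes ne: "carrier G \<noteq> {}"
  shows "G' = identities G \<longleftrightarrow> abelian_groupoid G"
proof
  assume "G' = identities G"
  then have "x \<cdot> y = y \<cdot> x" if "x \<in> isotropy G e" "y \<in> isotropy G e" for x y e
    using that commutator_in_commutator_subgroupoid commutator_identity_iff by blast
  then show "abelian_groupoid G"
    unfolding abelian_groupoid_def using groupoid_axioms comm_group_isotropy_iff by blast
next
  assume ab: "abelian_groupoid G"
  interpret groupoid_morphism G G id
    by unfold_locales (simp add: groupoid_hom_def)
  show "G' = identities G"
    using commutator_subgroupoid_kernel[OF ab ne] identities_subset_commutator_subgroupoid by auto
qed

lemma commutator_subgroupoid_subset_if_abelian_quotient:
  assumes H: "normal_subgroupoid H G" and ab: "abelian_groupoid (quotient_groupoid G H)"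
  shows "subgroupoid G' (restr G H)"
proof -
  let ?Q = "quotient_groupoid G H"
  have w: "wide_subgroupoid H G" and sH: "subgroupoid H G"
    using H by (auto simp: normal_subgroupoid_def wide_subgroupoid_iff)
  then have ne: "carrier G \<noteq> {}" using subgroupoidD(1,2)[OF sH] by blast
  interpret Q: groupoid ?Q using ab by (simp add: abelian_groupoid_def)
  interpret groupoid_morphism G ?Q "left_coset G H"
    by unfold_locales (rule left_coset_hom[OF H])
  note sG = subgroupoid_commutator_subgroupoid[OF ne]
  have "n \<in> H" if n: "n \<in> G'" for n
  proof -
    have c: "n \<in> carrier G" using subgroupoidD(2)[OF sG n] .
    \<comment> \<open>The coset of \<open>n\<close> is an identity, hence its own domain, and that
      domain is the coset of \<open>d n\<close>. The coset criterion then returns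
      \<open>n \<in> H\<close>.\<close>
    have "left_coset G H n = left_coset G H (d n)"
      using Q.identities_dom[OF commutator_subgroupoid_kernel[OF ab ne n]] map_dom[OF c] by simp
    then have "r n = r (d n)" "iv (d n) \<cdot> n \<in> H"
      using left_coset_eq_iff[OF w c dom_id_closed[OF c]] by blast+
    then show ?thesis using c by simp
  qed
  then show ?thesis using sH sG by (intro subgroupoid_restr) auto
qed

text \<open>The clause on domains is what \<open>G'\<close> adds to the general criterion:
  \<open>iv l \<cdot> g\<close> has domain \<open>d g\<close> and range \<open>d l\<close>, and
  elements of \<open>G'\<close> are isotropy elements.\<close>

lemma left_coset_commutator_subgroupoid_eq_iff:
  assumes ne: "carrier G \<noteq> {}" and c: "g \<in> carrier G" "l \<in> carrier G"
  shows "left_coset G G' g = left_coset G G' l \<longleftrightarrow> r g = r l \<and> d g = d l \<and> iv l \<cdot> g \<in> G'"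
proof -
  have "wide_subgroupoid G' G"
    using normal_commutator_subgroupoid[OF ne] by (simp add: normal_subgroupoid_def)
  then have "left_coset G G' g = left_coset G G' l \<longleftrightarrow> r g = r l \<and> iv l \<cdot> g \<in> G'"
    using c by (rule left_coset_eq_iff)
  moreover have "d g = d l" if "r g = r l" "iv l \<cdot> g \<in> G'"
    using commutator_subgroupoid_isotropy[OF ne that(2)] that(1) c by simp
  ultimately show ?thesis by blast
qed

text \<open>All representatives of a coset of \<open>G'\<close> share domain and range, so the
  existential over representatives can be evaluated at the given ones.\<close>

lemma quotient_commutator_defined_iff:
  assumes ne: "carrier G \<noteq> {}" and c: "g \<in> carrier G" "l \<in> carrier G"
  shows "defined (quotient_groupoid G G') (left_coset G G' g) (left_coset G G' l) \<longleftrightarrow> d g = r l"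
proof
  assume "defined (quotient_groupoid G G') (left_coset G G' g) (left_coset G G' l)"
  then obtain g' l' where g': "g' \<in> carrier G" "l' \<in> carrier G" "d g' = r l'"
    "left_coset G G' g = left_coset G G' g'" "left_coset G G' l = left_coset G G' l'"
    unfolding quotient_defined_iff defined_iff by blast
  then show "d g = r l"
    using left_coset_commutator_subgroupoid_eq_iff[OF ne] c by metis
next
  assume "d g = r l"
  with c show "defined (quotient_groupoid G G') (left_coset G G' g) (left_coset G G' l)"
    by (intro quotient_prd normal_commutator_subgroupoid ne)
qed

lemma groupoid_quotient_commutator:
  assumes ne: "carrier G \<noteq> {}"
  shows "groupoid (quotient_groupoid G G')"
proof (rule groupoid_image[where q = "left_coset G G'"])
  show "carrier (quotient_groupoid G G') = left_coset G G' ` carrier G"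
    by (simp add: quotient_groupoid_def)
  show "X \<in> carrier (quotient_groupoid G G') \<and> Y \<in> carrier (quotient_groupoid G G')"
    if "defined (quotient_groupoid G G') X Y" for X Y
    using that unfolding quotient_defined_iff by (auto simp: quotient_groupoid_def)
qed (use quotient_commutator_defined_iff[OF ne] quotient_prd(2)[OF normal_commutator_subgroupoid[OF ne]]
    in auto)

lemma abelian_quotient_commutator:
  assumes ne: "carrier G \<noteq> {}"
  shows "abelian_groupoid (quotient_groupoid G G')"
proof -
  let ?Q = "quotient_groupoid G G'" and ?q = "left_coset G G'"
  interpret Q: groupoid ?Q by (rule groupoid_quotient_commutator[OF ne])
  interpret groupoid_morphism G ?Q ?q
    by unfold_locales (rule left_coset_hom[OF normal_commutator_subgroupoid[OF ne]])
  have carQ: "carrier ?Q = ?q ` carrier G" by (simp add: quotient_groupoid_def)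
  have "prd ?Q X Y = prd ?Q Y X" if X: "X \<in> isotropy ?Q E" and Y: "Y \<in> isotropy ?Q E" for X Y E
  proof -
    obtain x y where c: "x \<in> carrier G" "y \<in> carrier G" and eq: "X = ?q x" "Y = ?q y"
      using Q.isotropyD(1)[OF X] Q.isotropyD(1)[OF Y] unfolding carQ by blast
    \<comment> \<open>Composability of these three pairs of cosets descends to the representatives
      and forces \<open>x\<close> and \<open>y\<close> into one isotropy group of \<open>G\<close>,
      where their commutator is available.\<close>
    have "defined ?Q (?q x) (?q x)" "defined ?Q (?q x) (?q y)" "defined ?Q (?q y) (?q x)"
      using Q.isotropyD[OF X] Q.isotropyD[OF Y] unfolding Q.defined_iff eq by blast+
    then have dr: "d x = r x" "d x = r y" "d y = r x"
      using quotient_commutator_defined_iff[OF ne] c by auto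
    then have i: "x \<in> isotropy G (d x)" "y \<in> isotropy G (d x)" using c by (auto simp: isotropy_def)
    have "iv (y \<cdot> x) \<cdot> (x \<cdot> y) \<in> G'"
      using commutator_in_commutator_subgroupoid[OF i] commutator_swap_eq[OF i] by simp
    then have "?q (x \<cdot> y) = ?q (y \<cdot> x)"
      using left_coset_commutator_subgroupoid_eq_iff[OF ne, of "x \<cdot> y" "y \<cdot> x"] c dr by simp
    then show ?thesis using c dr by (simp add: eq map_prd)
  qed
  then show ?thesis
    unfolding abelian_groupoid_def using Q.groupoid_axioms Q.comm_group_isotropy_iff by blast
qed

lemma abelian_hom_factors:
  assumes ne: "carrier G \<noteq> {}" and ab: "abelian_groupoid A" and hom: "\<sigma> \<in> groupoid_hom G A"
  shows "\<exists>\<theta> \<in> groupoid_hom (quotient_groupoid G G') A.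
    \<forall>g\<in>carrier G. \<sigma> g = (\<theta> \<circ> left_coset G G') g"
proof -
  let ?Q = "quotient_groupoid G G'" and ?q = "left_coset G G'"
  interpret A: groupoid A using ab by (simp add: abelian_groupoid_def)
  interpret groupoid_morphism G A \<sigma> by unfold_locales (rule hom)
  have carQ: "carrier ?Q = ?q ` carrier G" by (simp add: quotient_groupoid_def)
  \<comment> \<open>Equal cosets put \<open>iv l \<cdot> g\<close> into \<open>G'\<close>, which
    \<open>\<sigma>\<close> sends to identities; cancelling in \<open>A\<close> makes the images of
    \<open>g\<close> and \<open>l\<close> equal.\<close>
  have cong: "\<sigma> g = \<sigma> l" if c: "g \<in> carrier G" "l \<in> carrier G" and "?q g = ?q l" for g l
  proof (rule A.eq_if_ginv_prd_identity)
    have gl: "r g = r l" "iv l \<cdot> g \<in> G'"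
      using that left_coset_commutator_subgroupoid_eq_iff[OF ne] by auto
    show "ran_id A (\<sigma> g) = ran_id A (\<sigma> l)" using c gl by (simp add: map_ran)
    show "prd A (ginv A (\<sigma> l)) (\<sigma> g) \<in> identities A"
      using commutator_subgroupoid_kernel[OF ab ne gl(2)] c gl by (simp add: map_prd map_ginv)
  qed (use c in auto)
  \<comment> \<open>\<open>inv_into\<close> picks some representative of the coset; by
    \<open>cong\<close> the value does not depend on the choice.\<close>
  define \<theta> where "\<theta> X = \<sigma> (inv_into (carrier G) ?q X)" for X
  have \<theta>q: "\<theta> (?q g) = \<sigma> g" if "g \<in> carrier G" for g
    unfolding \<theta>_def using that by (intro cong inv_into_into f_inv_into_f) auto
  have "\<theta> \<in> groupoid_hom ?Q A"
    unfolding groupoid_hom_def carQ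
    using quotient_commutator_defined_iff[OF ne] quotient_prd(2)[OF normal_commutator_subgroupoid[OF ne]]
    by (auto simp: \<theta>q map_defined map_prd)
  with \<theta>q show ?thesis by (intro bexI[of _ \<theta>]) simp_all
qed

end

theorem proposition4p4:
  fixes G :: "'a partial_magma" and H :: "'a set"
  assumes "groupoid G" and "wide_subgroupoid H G"
  shows
    "(commutator_subgroupoid G =
          (\<Union>e\<in>identities G. derived (isotropy_group G e) (carrier (isotropy_group G e))) \<and>
        disjoint_family_on
          (\<lambda>e. derived (isotropy_group G e) (carrier (isotropy_group G e))) (identities G)) \<and>
     (commutator_subgroupoid G = identities G \<longleftrightarrow> abelian_groupoid G) \<and>
     (normal_subgroupoid H G \<longrightarrow>
        subgroupoid (mutual_commutator G H (carrier G)) (restr G H)) \<and>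
     (normal_subgroupoid (commutator_subgroupoid G) G \<and>
        abelian_groupoid (quotient_groupoid G (commutator_subgroupoid G))) \<and>
     (normal_subgroupoid H G \<and> abelian_groupoid (quotient_groupoid G H) \<longrightarrow>
        subgroupoid (commutator_subgroupoid G) (restr G H)) \<and>
     (left_coset G (commutator_subgroupoid G)
          \<in> groupoid_hom G (quotient_groupoid G (commutator_subgroupoid G)) \<and>
      (\<forall>(A :: 'b partial_magma) \<sigma>. abelian_groupoid A \<and> \<sigma> \<in> groupoid_hom G A \<longrightarrow>
        (\<exists>\<theta> \<in> groupoid_hom (quotient_groupoid G (commutator_subgroupoid G)) A.
          \<forall>g\<in>carrier G. \<sigma> g = (\<theta> \<circ> left_coset G (commutator_subgroupoid G)) g)))"
proof -
  interpret groupoid G by (rule assms)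
  \<comment> \<open>Subgroupoids are nonempty by definition, so the given \<open>H\<close> excludes
    the empty groupoid.\<close>
  have ne: "carrier G \<noteq> {}"
    using assms(2) by (auto simp: wide_subgroupoid_def subgroupoid_def)
  show ?thesis
    using commutator_subgroupoid_eq_derived[OF ne] disjoint_derived_isotropy
      commutator_subgroupoid_trivial_iff[OF ne] mutual_commutator_subset_normal
      normal_commutator_subgroupoid[OF ne] abelian_quotient_commutator[OF ne]
      commutator_subgroupoid_subset_if_abelian_quotient
      left_coset_hom[OF normal_commutator_subgroupoid[OF ne]] abelian_hom_factors[OF ne]
    by (intro conjI impI allI) (assumption | blast)+
qed

end
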